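(* Let $S,R$ be sets of the form $S=C\cup\{c_1\}$ and $R=D\cup\{d_1\}$, where $C,D$ are circles in the plane $\mathbb R^2$, $c_1$ is a point from the interior of $C$, and $d_1$ is a point from the interior of $D$. Then the sets $S$ and $R$ are betweenness isomorphic.
   Context: For $a,b\in\mathbb R^2$, $[a,b]$ is the closed segment and $(a,b)=[a,b]\setminus\{a,b\}$ the open segment (empty if $a=b$). A betweenness isomorphism of sets $S,R\subset\mathbb R^2$ is a bijection $f\colon S\to R$ such that for all $a,b,c\in S$: $c\in(a,b)\iff f(c)\in(f(a),f(b))$. $S$ and $R$ are betweenness isomorphic if there exists a betweenness isomorphism of $S$ and $R$. *)

theory Defs
  imports "HOL-Analysis.Analysis"
begin

definition betweenness_isomorphism ::
    "(real^2 \<Rightarrow> real^2) \<Rightarrow> (real^2) set \<Rightarrow> (real^2) set \<Rightarrow> bool" where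
  "betweenness_isomorphism f S R \<longleftrightarrow>
     bij_betw f S R \<and>
     (\<forall>a\<in>S. \<forall>b\<in>S. \<forall>c\<in>S.
        c \<in> open_segment a b \<longleftrightarrow> f c \<in> open_segment (f a) (f b))"

definition betweenness_isomorphic :: "(real^2) set \<Rightarrow> (real^2) set \<Rightarrow> bool" where
  "betweenness_isomorphic S R \<longleftrightarrow> (\<exists>f. betweenness_isomorphism f S R)"

end

theory Submission
  imports Defs
begin

text \<open>
  No point of a circle lies in an open segment between two points of its closed disc, so the only
  betweenness relations in \<open>C \<union> {c}\<close> are that \<open>c\<close> lies between the endpoints of each chord through
  it, i.e. between points of \<open>C\<close> seen from \<open>c\<close> in opposite directions. Radial projection from \<open>c\<close>
  is a bijection of \<open>C\<close> onto the unit circle of directions; composing it with the inverse of the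
  radial projection of \<open>D\<close> from \<open>d\<close> preserves directions, hence opposite ones.
\<close>

text \<open>Strictly between \<open>a\<close> and \<open>b\<close>, the distance to \<open>p\<close>
  is smaller than at one of the two endpoints, hence smaller than \<open>r\<close>.\<close>

lemma sphere_notin_open_segment_cball:
  fixes p :: "'a::euclidean_space"
  assumes "x \<in> sphere p r" "a \<in> cball p r" "b \<in> cball p r"
  shows "x \<notin> open_segment a b"
  using dist_decreases_open_segment[of x a b p] assms by fastforce

lemma norm_scaleR_sgn: "norm x *\<^sub>R sgn x = (x :: 'a::real_normed_vector)"
  by (cases "x = 0") (simp_all add: sgn_div_norm)

lemma in_open_segment_iff_sgn_opposite:
  fixes a b c :: "'a::real_normed_vector"
  assumes "a \<noteq> c" "b \<noteq> c"
  shows "c \<in> open_segment a b \<longleftrightarrow> sgn (b - c) = - sgn (a - c)"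
proof
  assume "c \<in> open_segment a b"
  then obtain u where u: "0 < u" "u < 1" "c = (1 - u) *\<^sub>R a + u *\<^sub>R b"
    by (auto simp: in_segment)
  \<comment> \<open>Both factors are positive, so \<open>sgn\<close> discards them and only the
    directions remain.\<close>
  then have "u *\<^sub>R (b - c) = - ((1 - u) *\<^sub>R (a - c))"
    by (simp add: algebra_simps)
  then have "sgn (u *\<^sub>R (b - c)) = sgn (- ((1 - u) *\<^sub>R (a - c)))"
    by (rule arg_cong)
  then show "sgn (b - c) = - sgn (a - c)"
    using u by (simp add: sgn_scaleR sgn_minus del: scaleR_minus_right)
next
  assume opp: "sgn (b - c) = - sgn (a - c)"
  define A B where "A = norm (a - c)" and "B = norm (b - c)"
  have pos: "0 < A" "0 < B"
    using assms by (auto simp: A_def B_def)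
  have a: "a = c + A *\<^sub>R sgn (a - c)" and b: "b = c - B *\<^sub>R sgn (a - c)"
    using norm_scaleR_sgn[of "a - c"] norm_scaleR_sgn[of "b - c"] opp
    by (simp_all add: A_def B_def algebra_simps)
  \<comment> \<open>\<open>in_segment\<close> demands distinct endpoints; if they coincided, a
    direction would equal its own negative and vanish.\<close>
  have "a \<noteq> b"
  proof
    assume "a = b"
    with opp have "sgn (a - c) = 0"
      by (simp add: eq_neg_iff_add_eq_0 flip: scaleR_2)
    with assms show False
      by (simp add: sgn_zero_iff)
  qed
  \<comment> \<open>The point \<open>c\<close> divides the segment in the ratio \<open>A\<close> to
    \<open>B\<close>: with these weights the opposite displacements from \<open>c\<close> both have
    length \<open>A * B / (A + B)\<close> and cancel.\<close>
  moreover have "c = (1 - A / (A + B)) *\<^sub>R a + (A / (A + B)) *\<^sub>R b"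
  proof -
    define v where "v = sgn (a - c)"
    have "(1 - A / (A + B)) *\<^sub>R (c + A *\<^sub>R v) + (A / (A + B)) *\<^sub>R (c - B *\<^sub>R v)
        = c + ((1 - A / (A + B)) * A - (A / (A + B)) * B) *\<^sub>R v"
      by (simp add: algebra_simps)
    also have "(1 - A / (A + B)) * A - (A / (A + B)) * B = 0"
      using pos by (simp add: field_simps)
    finally show ?thesis
      using a b by (simp add: v_def)
  qed
  moreover have "0 < A / (A + B)" "A / (A + B) < 1"
    using pos by auto
  ultimately show "c \<in> open_segment a b"
    unfolding in_segment by blast
qed

text \<open>Injectivity: of two sphere points on one ray from \<open>c\<close>, the nearer would lie
  strictly between \<open>c\<close> and the farther. Surjectivity: every ray from \<open>c\<close>
  leaves the bounded ball through its frontier.\<close>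

lemma bij_betw_sgn_sphere:
  fixes c p :: "'a::euclidean_space"
  assumes c: "c \<in> ball p r"
  shows "bij_betw (\<lambda>a. sgn (a - c)) (sphere p r) (sphere 0 1)"
proof (rule bij_betw_imageI)
  have neq: "a \<noteq> c" if "a \<in> sphere p r" for a
    using that c by auto
  have shorter: False
    if "a \<in> sphere p r" "b \<in> sphere p r" "sgn (a - c) = sgn (b - c)"
      "norm (a - c) < norm (b - c)" for a b
  proof -
    \<comment> \<open>On the common ray, \<open>a\<close> lies at the fraction \<open>u\<close> of
      the way from \<open>c\<close> to \<open>b\<close>.\<close>
    define u where "u = norm (a - c) / norm (b - c)"
    have "a - c = norm (a - c) *\<^sub>R sgn (b - c)"
      using norm_scaleR_sgn[of "a - c"] that(3) by simp
    then have "a = (1 - u) *\<^sub>R c + u *\<^sub>R b"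
      by (simp add: u_def sgn_div_norm algebra_simps divide_inverse)
    moreover have "0 < u" "u < 1"
      using that(4) neq[OF that(1)] neq[OF that(2)] by (auto simp: u_def)
    ultimately have "a \<in> open_segment c b"
      using neq[OF that(2)] by (auto simp: in_segment)
    then show False
      using sphere_notin_open_segment_cball[OF that(1), of c b] c that(2) by auto
  qed
  show "inj_on (\<lambda>a. sgn (a - c)) (sphere p r)"
  proof (rule inj_onI)
    fix a b
    assume ab: "a \<in> sphere p r" "b \<in> sphere p r" and eq: "sgn (a - c) = sgn (b - c)"
    have "norm (a - c) = norm (b - c)"
      using shorter[OF ab eq] shorter[OF ab(2,1) eq[symmetric]] by (meson linorder_neqE)
    with eq neq[OF ab(1)] neq[OF ab(2)] show "a = b"
      by (simp add: sgn_div_norm)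
  qed
  show "(\<lambda>a. sgn (a - c)) ` sphere p r = sphere 0 1"
  proof (intro subset_antisym subsetI)
    fix v assume "v \<in> (\<lambda>a. sgn (a - c)) ` sphere p r"
    then show "v \<in> sphere 0 1"
      using neq by (auto simp: norm_sgn)
  next
    fix v :: 'a assume "v \<in> sphere 0 1"
    then have v: "norm v = 1" by simp
    have "0 < r"
      using c by (metis ball_eq_empty empty_iff not_le)
    obtain d where d: "0 < d" "c + d *\<^sub>R v \<in> frontier (ball p r)"
      using ray_to_frontier[of "ball p r" c v] c v by (metis bounded_ball interior_ball norm_zero zero_neq_one)
    then have "c + d *\<^sub>R v \<in> sphere p r"
      using \<open>0 < r\<close> by (simp add: frontier_ball)
    moreover have "sgn (c + d *\<^sub>R v - c) = v"
      using d(1) v by (simp add: sgn_scaleR) (simp add: sgn_div_norm)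
    ultimately show "v \<in> (\<lambda>a. sgn (a - c)) ` sphere p r"
      by force
  qed
qed

theorem theorem4p1:
  fixes S R C D :: "(real^2) set" and p q c\<^sub>1 d\<^sub>1 :: "real^2" and r s :: real
  assumes "0 < r" and "C = sphere p r" and "c\<^sub>1 \<in> ball p r"
    and "0 < s" and "D = sphere q s" and "d\<^sub>1 \<in> ball q s"
    and "S = C \<union> {c\<^sub>1}" and "R = D \<union> {d\<^sub>1}"
  shows "betweenness_isomorphic S R"
proof -
  have notC: "c\<^sub>1 \<notin> C" and notD: "d\<^sub>1 \<notin> D"
    using assms by auto
  define h where "h = inv_into D (\<lambda>x. sgn (x - d\<^sub>1))"
  \<comment> \<open>The interior point needs its own case: \<open>sgn 0 = 0\<close> is not a unit
    vector, so \<open>h\<close> is not controlled there.\<close>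
  define f where "f = (\<lambda>a. if a = c\<^sub>1 then d\<^sub>1 else h (sgn (a - c\<^sub>1)))"
  have bijC: "bij_betw (\<lambda>a. sgn (a - c\<^sub>1)) C (sphere 0 1)"
    and bijD: "bij_betw (\<lambda>a. sgn (a - d\<^sub>1)) D (sphere 0 1)"
    using bij_betw_sgn_sphere assms by auto
  have "bij_betw (h \<circ> (\<lambda>a. sgn (a - c\<^sub>1))) C D"
    using bij_betw_trans[OF bijC bij_betw_inv_into[OF bijD]] by (simp add: h_def)
  then have bij_f: "bij_betw f C D"
    using notC by (subst bij_betw_cong[where g = "h \<circ> (\<lambda>a. sgn (a - c\<^sub>1))"]) (auto simp: f_def)
  have fc: "f c\<^sub>1 = d\<^sub>1"
    by (simp add: f_def)
  have bij: "bij_betw f S R"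
    using notC notD bij_f fc assms(7,8) notIn_Un_bij_betw[of c\<^sub>1 C f D] by simp
  have fD: "f a \<in> D" if "a \<in> C" for a
    using bij_f that by (rule bij_betw_apply)
  have direction: "sgn (f a - d\<^sub>1) = sgn (a - c\<^sub>1)" if "a \<in> C" for a
    using that notC bij_betw_inv_into_right[OF bijD] bij_betw_apply[OF bijC that]
    by (auto simp: f_def h_def)
  have "c \<in> open_segment a b \<longleftrightarrow> f c \<in> open_segment (f a) (f b)"
    if S: "a \<in> S" "b \<in> S" "c \<in> S" for a b c
  proof (cases "c = c\<^sub>1")
    \<comment> \<open>Both sides are false: \<open>c\<close> and \<open>f c\<close> lie on the
      circles, while all possible endpoints lie in the closed discs.\<close>
    case False
    then have "c \<in> C"
      using S(3) assms(7) by simp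
    moreover have "S \<subseteq> cball p r" "R \<subseteq> cball q s"
      using assms by auto
    moreover have "f a \<in> R" "f b \<in> R"
      using bij S by (auto dest: bij_betw_apply)
    ultimately show ?thesis
      using sphere_notin_open_segment_cball[of c p r a b]
        sphere_notin_open_segment_cball[of "f c" q s "f a" "f b"] fD[of c] S assms(2,5) by blast
  next
    case c: True
    show ?thesis
    proof (cases "a = c\<^sub>1 \<or> b = c\<^sub>1")
      case True
      \<comment> \<open>Again both sides are false, since an open segment omits its
        endpoints.\<close>
      then show ?thesis
        using c fc by (auto simp: open_segment_def)
    next
      case False
      then have ab: "a \<in> C" "b \<in> C"
        using S assms(7) by auto
      then have "f a \<noteq> d\<^sub>1" "f b \<noteq> d\<^sub>1"
        using fD notD by metis+
      with False show ?thesis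
        \<comment> \<open>Both sides become the same equation between directions, as
          \<open>f\<close> preserves them.\<close>
        by (simp add: c fc in_open_segment_iff_sgn_opposite direction ab)
    qed
  qed
  with bij show ?thesis
    unfolding betweenness_isomorphic_def betweenness_isomorphism_def by blast
qed

end
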